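(* Every extension $L$ of the logic $\mathbf{IL}^-(\mathbf{J4}_+)$ satisfies the uniqueness of fixed points (UFP): for any propositional variables $p,q$ and any formula $A(p)$ which is modalized in $p$ and does not contain $q$, $$L \vdash \boxdot(p \leftrightarrow A(p)) \land \boxdot(q \leftrightarrow A(q)) \to (p \leftrightarrow q).$$
   Context: Formulas are generated by $A ::= \bot \mid p \mid A \to A \mid \Box A \mid A \rhd A$, where $p$ ranges over a countably infinite set of propositional variables. The symbols $\neg,\land,\lor,\leftrightarrow,\top,\Diamond$ (with $\Diamond A := \neg\Box\neg A$) are the usual abbreviations, and $\boxdot A := A \land \Box A$. $\neg,\Box,\Diamond,\boxdot$ bind most strongly. For a formula $A(p)$, $A(B)$ denotes the result of substituting $B$ for all occurrences of $p$ in $A(p)$. The logic $\mathbf{IL}^-$ has as axioms all instances of: $\mathbf{L1}$: all tautologies in this language; $\mathbf{L2}$: $\Box(A\to B)\to(\Box A\to\Box B)$; $\mathbf{L3}$: $\Box(\Box A\to A)\to\Box A$; $\mathbf{J3}$: $((A\rhd C)\land(B\rhd C))\to((A\lor B)\rhd C)$; $\mathbf{J6}$: $\Box A\leftrightarrow((\neg A)\rhd\bot)$. Its inference rules are Modus Ponens, Necessitation (from $A$ infer $\Box A$), $\mathbf{R1}$ (from $A\to B$ infer $(C\rhd A)\to(C\rhd B)$) and $\mathbf{R2}$ (from $A\to B$ infer $(B\rhd C)\to(A\rhd C)$). $\mathbf{IL}^-(\Sigma_1,\ldots,\Sigma_n)$ is the logic obtained from $\mathbf{IL}^-$ by adding the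 schemata $\Sigma_1,\ldots,\Sigma_n$ as axiom schemata (with the same rules). $\mathbf{J4}_+$ is the schema $\Box(A\to B)\to((C\rhd A)\to(C\rhd B))$. $L \vdash A$ means that $A$ is a theorem of $L$. $L$ is an extension of $L'$ if every theorem of $L'$ is a theorem of $L$. A formula $A$ is modalized in $p$ if every occurrence of $p$ in $A$ is in the scope of some modal operator $\Box$ or $\rhd$. *)

theory Defs
  imports Main
begin

datatype fm =
    Bot  ("\<^bold>\<bottom>")
  | Var nat
  | Imp fm fm  (infixr "\<^bold>\<rightarrow>" 55)
  | Box fm  ("\<box> _" [80] 80)
  | Rhd fm fm  (infix "\<rhd>" 60)

abbreviation Neg :: "fm \<Rightarrow> fm"  ("\<^bold>\<not> _" [80] 80)
  where "\<^bold>\<not> A \<equiv> A \<^bold>\<rightarrow> \<^bold>\<bottom>"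

abbreviation Disj :: "fm \<Rightarrow> fm \<Rightarrow> fm"  (infixr "\<^bold>\<or>" 65)
  where "A \<^bold>\<or> B \<equiv> \<^bold>\<not> A \<^bold>\<rightarrow> B"

abbreviation Conj :: "fm \<Rightarrow> fm \<Rightarrow> fm"  (infixr "\<^bold>\<and>" 70)
  where "A \<^bold>\<and> B \<equiv> \<^bold>\<not> (A \<^bold>\<rightarrow> \<^bold>\<not> B)"

abbreviation Iff :: "fm \<Rightarrow> fm \<Rightarrow> fm"  (infix "\<^bold>\<leftrightarrow>" 53)
  where "A \<^bold>\<leftrightarrow> B \<equiv> (A \<^bold>\<rightarrow> B) \<^bold>\<and> (B \<^bold>\<rightarrow> A)"

abbreviation Boxdot :: "fm \<Rightarrow> fm"  ("\<boxdot> _" [80] 80)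
  where "\<boxdot> A \<equiv> A \<^bold>\<and> \<box> A"

primrec vars :: "fm \<Rightarrow> nat set" where
  "vars \<^bold>\<bottom> = {}"
| "vars (Var r) = {r}"
| "vars (A \<^bold>\<rightarrow> B) = vars A \<union> vars B"
| "vars (\<box> A) = vars A"
| "vars (A \<rhd> B) = vars A \<union> vars B"

(* subst p B A is the formula A(B), where A = A(p). *)
primrec subst :: "nat \<Rightarrow> fm \<Rightarrow> fm \<Rightarrow> fm" where
  "subst p C \<^bold>\<bottom> = \<^bold>\<bottom>"
| "subst p C (Var r) = (if r = p then C else Var r)"
| "subst p C (A \<^bold>\<rightarrow> B) = subst p C A \<^bold>\<rightarrow> subst p C B"
| "subst p C (\<box> A) = \<box> (subst p C A)"
| "subst p C (A \<rhd> B) = subst p C A \<rhd> subst p C B"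

(* Every occurrence of p lies in the scope of some modal operator. *)
primrec modalized :: "nat \<Rightarrow> fm \<Rightarrow> bool" where
  "modalized p \<^bold>\<bottom> \<longleftrightarrow> True"
| "modalized p (Var r) \<longleftrightarrow> r \<noteq> p"
| "modalized p (A \<^bold>\<rightarrow> B) \<longleftrightarrow> modalized p A \<and> modalized p B"
| "modalized p (\<box> A) \<longleftrightarrow> True"
| "modalized p (A \<rhd> B) \<longleftrightarrow> True"

(* Boolean evaluation: variables and formulas whose main connective is modal
   are treated as atoms, with values given by v. *)
primrec truth :: "(fm \<Rightarrow> bool) \<Rightarrow> fm \<Rightarrow> bool" where
  "truth v \<^bold>\<bottom> \<longleftrightarrow> False"
| "truth v (Var r) \<longleftrightarrow> v (Var r)"
| "truth v (A \<^bold>\<rightarrow> B) \<longleftrightarrow> (truth v A \<longrightarrow> truth v B)"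
| "truth v (\<box> A) \<longleftrightarrow> v (\<box> A)"
| "truth v (A \<rhd> B) \<longleftrightarrow> v (A \<rhd> B)"

definition tautology :: "fm \<Rightarrow> bool" where
  "tautology A \<longleftrightarrow> (\<forall>v. truth v A)"

(* A logic is represented by its set of theorems. IL_minus \<Sigma> adds to the basic
   axioms all formulas in \<Sigma>, which stands for the set of instances of the
   additional schemata; the unextended logic is IL_minus {}. *)
inductive_set IL_minus :: "fm set \<Rightarrow> fm set" for \<Sigma> :: "fm set" where
  L1: "tautology A \<Longrightarrow> A \<in> IL_minus \<Sigma>"
| L2: "\<box> (A \<^bold>\<rightarrow> B) \<^bold>\<rightarrow> (\<box> A \<^bold>\<rightarrow> \<box> B) \<in> IL_minus \<Sigma>"
| L3: "\<box> (\<box> A \<^bold>\<rightarrow> A) \<^bold>\<rightarrow> \<box> A \<in> IL_minus \<Sigma>"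
| J3: "((A \<rhd> C) \<^bold>\<and> (B \<rhd> C)) \<^bold>\<rightarrow> ((A \<^bold>\<or> B) \<rhd> C) \<in> IL_minus \<Sigma>"
| J6: "(\<box> A \<^bold>\<leftrightarrow> ((\<^bold>\<not> A) \<rhd> \<^bold>\<bottom>)) \<in> IL_minus \<Sigma>"
| Ax: "A \<in> \<Sigma> \<Longrightarrow> A \<in> IL_minus \<Sigma>"
| MP: "A \<^bold>\<rightarrow> B \<in> IL_minus \<Sigma> \<Longrightarrow> A \<in> IL_minus \<Sigma> \<Longrightarrow> B \<in> IL_minus \<Sigma>"
| Nec: "A \<in> IL_minus \<Sigma> \<Longrightarrow> \<box> A \<in> IL_minus \<Sigma>"
| R1: "A \<^bold>\<rightarrow> B \<in> IL_minus \<Sigma> \<Longrightarrow> (C \<rhd> A) \<^bold>\<rightarrow> (C \<rhd> B) \<in> IL_minus \<Sigma>"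
| R2: "A \<^bold>\<rightarrow> B \<in> IL_minus \<Sigma> \<Longrightarrow> (B \<rhd> C) \<^bold>\<rightarrow> (A \<rhd> C) \<in> IL_minus \<Sigma>"

definition J4plus :: "fm set" where
  "J4plus = {\<box> (A \<^bold>\<rightarrow> B) \<^bold>\<rightarrow> ((C \<rhd> A) \<^bold>\<rightarrow> (C \<rhd> B)) | A B C. True}"

abbreviation provable :: "fm set \<Rightarrow> fm \<Rightarrow> bool"  (infix "\<turnstile>" 50)
  where "L \<turnstile> A \<equiv> A \<in> L"

(* No closure condition is imposed on L beyond containing the theorems of L'. *)
definition extension :: "fm set \<Rightarrow> fm set \<Rightarrow> bool" where
  "extension L L' \<longleftrightarrow> (\<forall>A. L' \<turnstile> A \<longrightarrow> L \<turnstile> A)"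

definition UFP :: "fm set \<Rightarrow> bool" where
  "UFP L \<longleftrightarrow> (\<forall>p q A. modalized p A \<and> q \<notin> vars A \<longrightarrow>
     L \<turnstile> \<boxdot> (Var p \<^bold>\<leftrightarrow> A) \<^bold>\<and> \<boxdot> (Var q \<^bold>\<leftrightarrow> subst p (Var q) A) \<^bold>\<rightarrow> (Var p \<^bold>\<leftrightarrow> Var q))"

end

theory Submission
  imports Defs
begin

text \<open>
  By \<open>J4\<^sub>+\<close> the operator \<open>\<rhd>\<close> respects boxed equivalence in its right argument. In the left one this
  already follows from \<open>J3\<close> and \<open>J6\<close>: \<open>\<box> (A \<rightarrow> B)\<close> is equivalent to \<open>(A \<and> \<not> B) \<rhd> \<bottom>\<close>, which together
  with \<open>B \<rhd> C\<close> gives \<open>A \<rhd> C\<close>. Hence \<open>\<box> (p \<leftrightarrow> q)\<close> implies \<open>A(p) \<leftrightarrow> A(q)\<close> for \<open>A\<close> modalized in \<open>p\<close>, so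
  the two fixed point equations imply \<open>\<box> (p \<leftrightarrow> q) \<rightarrow> (p \<leftrightarrow> q)\<close>. As they also imply their own
  necessitation, the Loeb axiom \<open>L3\<close> yields \<open>\<box> (p \<leftrightarrow> q)\<close> and thus \<open>p \<leftrightarrow> q\<close>.
\<close>

lemma taut_mp:
  assumes "A \<in> IL_minus \<Sigma>" "tautology (A \<^bold>\<rightarrow> B)"
  shows "B \<in> IL_minus \<Sigma>"
  using IL_minus.MP[OF IL_minus.L1[OF assms(2)] assms(1)] .

lemma taut_mp2:
  assumes "A \<in> IL_minus \<Sigma>" "B \<in> IL_minus \<Sigma>" "tautology (A \<^bold>\<rightarrow> B \<^bold>\<rightarrow> C)"
  shows "C \<in> IL_minus \<Sigma>"
  using IL_minus.MP[OF taut_mp[OF assms(1,3)] assms(2)] .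

lemma imp_trans:
  assumes "A \<^bold>\<rightarrow> B \<in> IL_minus \<Sigma>" "B \<^bold>\<rightarrow> C \<in> IL_minus \<Sigma>"
  shows "A \<^bold>\<rightarrow> C \<in> IL_minus \<Sigma>"
  using assms by (rule taut_mp2) (simp add: tautology_def)

lemma imp_conjI:
  assumes "A \<^bold>\<rightarrow> B \<in> IL_minus \<Sigma>" "A \<^bold>\<rightarrow> C \<in> IL_minus \<Sigma>"
  shows "A \<^bold>\<rightarrow> B \<^bold>\<and> C \<in> IL_minus \<Sigma>"
  using assms by (rule taut_mp2) (simp add: tautology_def)

lemma box_mono:
  assumes "A \<^bold>\<rightarrow> B \<in> IL_minus \<Sigma>"
  shows "\<box> A \<^bold>\<rightarrow> \<box> B \<in> IL_minus \<Sigma>"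
  using IL_minus.MP[OF IL_minus.L2 IL_minus.Nec[OF assms]] .

lemma box_conj: "\<box> A \<^bold>\<and> \<box> B \<^bold>\<rightarrow> \<box> (A \<^bold>\<and> B) \<in> IL_minus \<Sigma>"
proof -
  have "\<box> A \<^bold>\<rightarrow> \<box> (B \<^bold>\<rightarrow> A \<^bold>\<and> B) \<in> IL_minus \<Sigma>"
    by (intro box_mono IL_minus.L1) (simp add: tautology_def)
  then show ?thesis
    using IL_minus.L2[of B "A \<^bold>\<and> B" \<Sigma>]
    by (rule taut_mp2) (simp add: tautology_def)
qed

text \<open>Transitivity is derived from \<open>L3\<close>, applied to \<boxdot> A: since \<box>
  (\<boxdot> A) gives \<box> A, the formula A implies \<box> (\<boxdot> A) -> \<boxdot> A. Boxing
  this and applying \<open>L3\<close> leads from \<box> A to \<box> (\<boxdot> A), hence to \<box>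
  \<box> A.\<close>

lemma box_four: "\<box> A \<^bold>\<rightarrow> \<box> \<box> A \<in> IL_minus \<Sigma>"
proof -
  have l: "\<box> (\<boxdot> A) \<^bold>\<rightarrow> \<box> A \<in> IL_minus \<Sigma>"
    by (intro box_mono IL_minus.L1) (simp add: tautology_def)
  then have "A \<^bold>\<rightarrow> (\<box> (\<boxdot> A) \<^bold>\<rightarrow> \<boxdot> A) \<in> IL_minus \<Sigma>"
    by (rule taut_mp) (simp add: tautology_def)
  then have "\<box> A \<^bold>\<rightarrow> \<box> (\<boxdot> A) \<in> IL_minus \<Sigma>"
    by (rule imp_trans[OF box_mono IL_minus.L3])
  moreover have "\<box> (\<boxdot> A) \<^bold>\<rightarrow> \<box> \<box> A \<in> IL_minus \<Sigma>"
    by (intro box_mono IL_minus.L1) (simp add: tautology_def)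
  ultimately show ?thesis by (rule imp_trans)
qed

lemma box_boxdot: "\<box> A \<^bold>\<rightarrow> \<box> (\<boxdot> A) \<in> IL_minus \<Sigma>"
proof -
  have "\<box> A \<^bold>\<rightarrow> \<box> A \<^bold>\<and> \<box> \<box> A \<in> IL_minus \<Sigma>"
    using box_four[of A \<Sigma>] by (rule taut_mp) (simp add: tautology_def)
  then show ?thesis
    using box_conj by (rule imp_trans)
qed

lemma boxdot_imp_box_boxdot: "\<boxdot> A \<^bold>\<rightarrow> \<box> (\<boxdot> A) \<in> IL_minus \<Sigma>"
  using box_boxdot[of A \<Sigma>] by (rule taut_mp) (simp add: tautology_def)

text \<open>Because X implies \<box> X, the second premise can be boxed without losing X as its
  hypothesis: X yields \<box> (\<box> A -> A), and \<open>L3\<close> applies.\<close>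

lemma loeb_rule:
  assumes "X \<^bold>\<rightarrow> \<box> X \<in> IL_minus \<Sigma>" "X \<^bold>\<rightarrow> (\<box> A \<^bold>\<rightarrow> A) \<in> IL_minus \<Sigma>"
  shows "X \<^bold>\<rightarrow> A \<in> IL_minus \<Sigma>"
proof -
  have "X \<^bold>\<rightarrow> \<box> A \<in> IL_minus \<Sigma>"
    using imp_trans[OF box_mono[OF assms(2)] IL_minus.L3] by (rule imp_trans[OF assms(1)])
  then show ?thesis
    using assms(2) by (rule taut_mp2) (simp add: tautology_def)
qed

lemma rhd_left_mono:
  "\<box> (A \<^bold>\<rightarrow> B) \<^bold>\<rightarrow> ((B \<rhd> C) \<^bold>\<rightarrow> (A \<rhd> C)) \<in> IL_minus \<Sigma>"
proof -
  let ?N = "\<^bold>\<not> (A \<^bold>\<rightarrow> B)"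
  \<comment> \<open>\<open>?N\<close> is propositionally A and not B. \<open>J6\<close> turns \<box>
    (A -> B) into \<open>?N\<close> \<rhd> \<bottom>, and ex falso under \<open>R1\<close> replaces
    \<bottom> by C.\<close>
  have "(?N \<rhd> \<^bold>\<bottom>) \<^bold>\<rightarrow> (?N \<rhd> C) \<in> IL_minus \<Sigma>"
    by (intro IL_minus.R1 IL_minus.L1) (simp add: tautology_def)
  with IL_minus.J6[of "A \<^bold>\<rightarrow> B" \<Sigma>] have "\<box> (A \<^bold>\<rightarrow> B) \<^bold>\<rightarrow> (?N \<rhd> C) \<in> IL_minus \<Sigma>"
    by (rule taut_mp2) (simp add: tautology_def)
  \<comment> \<open>A implies the disjunction of \<open>?N\<close> and B, so a case split by
    \<open>J3\<close> followed by \<open>R2\<close> reaches A \<rhd> C.\<close>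
  moreover have "((?N \<^bold>\<or> B) \<rhd> C) \<^bold>\<rightarrow> (A \<rhd> C) \<in> IL_minus \<Sigma>"
    by (intro IL_minus.R2 IL_minus.L1) (simp add: tautology_def)
  then have "(?N \<rhd> C) \<^bold>\<and> (B \<rhd> C) \<^bold>\<rightarrow> (A \<rhd> C) \<in> IL_minus \<Sigma>"
    by (rule imp_trans[OF IL_minus.J3])
  ultimately show ?thesis
    by (rule taut_mp2) (simp add: tautology_def)
qed

lemma rhd_right_mono:
  assumes "J4plus \<subseteq> \<Sigma>"
  shows "\<box> (A \<^bold>\<rightarrow> B) \<^bold>\<rightarrow> ((C \<rhd> A) \<^bold>\<rightarrow> (C \<rhd> B)) \<in> IL_minus \<Sigma>"
  using assms by (intro IL_minus.Ax) (auto simp: J4plus_def)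

lemma box_cong:
  "\<box> (A \<^bold>\<leftrightarrow> B) \<^bold>\<rightarrow> (\<box> A \<^bold>\<leftrightarrow> \<box> B) \<in> IL_minus \<Sigma>"
proof (rule imp_conjI)
  have "\<box> (A \<^bold>\<leftrightarrow> B) \<^bold>\<rightarrow> \<box> (A \<^bold>\<rightarrow> B) \<in> IL_minus \<Sigma>"
    by (intro box_mono IL_minus.L1) (simp add: tautology_def)
  then show "\<box> (A \<^bold>\<leftrightarrow> B) \<^bold>\<rightarrow> (\<box> A \<^bold>\<rightarrow> \<box> B) \<in> IL_minus \<Sigma>"
    using IL_minus.L2 by (rule imp_trans)
  have "\<box> (A \<^bold>\<leftrightarrow> B) \<^bold>\<rightarrow> \<box> (B \<^bold>\<rightarrow> A) \<in> IL_minus \<Sigma>"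
    by (intro box_mono IL_minus.L1) (simp add: tautology_def)
  then show "\<box> (A \<^bold>\<leftrightarrow> B) \<^bold>\<rightarrow> (\<box> B \<^bold>\<rightarrow> \<box> A) \<in> IL_minus \<Sigma>"
    using IL_minus.L2 by (rule imp_trans)
qed

lemma rhd_imp:
  assumes "J4plus \<subseteq> \<Sigma>"
  shows "\<box> (A \<^bold>\<leftrightarrow> B) \<^bold>\<and> \<box> (C \<^bold>\<leftrightarrow> D) \<^bold>\<rightarrow> ((A \<rhd> C) \<^bold>\<rightarrow> (B \<rhd> D)) \<in> IL_minus \<Sigma>"
proof -
  have "\<box> (A \<^bold>\<leftrightarrow> B) \<^bold>\<rightarrow> \<box> (B \<^bold>\<rightarrow> A) \<in> IL_minus \<Sigma>"
    by (intro box_mono IL_minus.L1) (simp add: tautology_def)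
  then have left: "\<box> (A \<^bold>\<leftrightarrow> B) \<^bold>\<rightarrow> ((A \<rhd> C) \<^bold>\<rightarrow> (B \<rhd> C)) \<in> IL_minus \<Sigma>"
    using rhd_left_mono by (rule imp_trans)
  have "\<box> (C \<^bold>\<leftrightarrow> D) \<^bold>\<rightarrow> \<box> (C \<^bold>\<rightarrow> D) \<in> IL_minus \<Sigma>"
    by (intro box_mono IL_minus.L1) (simp add: tautology_def)
  then have "\<box> (C \<^bold>\<leftrightarrow> D) \<^bold>\<rightarrow> ((B \<rhd> C) \<^bold>\<rightarrow> (B \<rhd> D)) \<in> IL_minus \<Sigma>"
    using rhd_right_mono[OF assms] by (rule imp_trans)
  with left show ?thesis
    by (rule taut_mp2) (simp add: tautology_def)
qed

lemma box_iff_sym: "\<box> (A \<^bold>\<leftrightarrow> B) \<^bold>\<rightarrow> \<box> (B \<^bold>\<leftrightarrow> A) \<in> IL_minus \<Sigma>"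
  by (intro box_mono IL_minus.L1) (simp add: tautology_def)

lemma rhd_cong:
  assumes "J4plus \<subseteq> \<Sigma>"
  shows "\<box> (A \<^bold>\<leftrightarrow> B) \<^bold>\<and> \<box> (C \<^bold>\<leftrightarrow> D) \<^bold>\<rightarrow> ((A \<rhd> C) \<^bold>\<leftrightarrow> (B \<rhd> D)) \<in> IL_minus \<Sigma>"
proof (rule imp_conjI)
  have "\<box> (A \<^bold>\<leftrightarrow> B) \<^bold>\<and> \<box> (C \<^bold>\<leftrightarrow> D) \<^bold>\<rightarrow> \<box> (B \<^bold>\<leftrightarrow> A) \<^bold>\<and> \<box> (D \<^bold>\<leftrightarrow> C) \<in> IL_minus \<Sigma>"
    using box_iff_sym[of A B \<Sigma>] box_iff_sym[of C D \<Sigma>]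
    by (rule taut_mp2) (simp add: tautology_def)
  then show "\<box> (A \<^bold>\<leftrightarrow> B) \<^bold>\<and> \<box> (C \<^bold>\<leftrightarrow> D) \<^bold>\<rightarrow> ((B \<rhd> D) \<^bold>\<rightarrow> (A \<rhd> C)) \<in> IL_minus \<Sigma>"
    using rhd_imp[OF assms] by (rule imp_trans)
qed (rule rhd_imp[OF assms])

text \<open>The premise X is arbitrary because both substitution lemmas use this step, one under
  \<boxdot> and the other under \<box>.\<close>

lemma imp_cong_under:
  assumes "X \<^bold>\<rightarrow> (A \<^bold>\<leftrightarrow> B) \<in> IL_minus \<Sigma>" "X \<^bold>\<rightarrow> (C \<^bold>\<leftrightarrow> D) \<in> IL_minus \<Sigma>"
  shows "X \<^bold>\<rightarrow> ((A \<^bold>\<rightarrow> C) \<^bold>\<leftrightarrow> (B \<^bold>\<rightarrow> D)) \<in> IL_minus \<Sigma>"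
  using assms by (rule taut_mp2) (unfold tautology_def truth.simps, blast)

text \<open>Under a box, \<box> E provides not only E but \<boxdot> E, by transitivity. This is why
  the boxed equivalence alone suffices for the arguments of modal operators.\<close>

lemma box_imp_of_boxdot_imp:
  assumes "\<boxdot> E \<^bold>\<rightarrow> A \<in> IL_minus \<Sigma>"
  shows "\<box> E \<^bold>\<rightarrow> \<box> A \<in> IL_minus \<Sigma>"
  using box_boxdot box_mono[OF assms] by (rule imp_trans)

lemma box_cong_under:
  assumes "\<boxdot> E \<^bold>\<rightarrow> (A \<^bold>\<leftrightarrow> B) \<in> IL_minus \<Sigma>"
  shows "\<box> E \<^bold>\<rightarrow> (\<box> A \<^bold>\<leftrightarrow> \<box> B) \<in> IL_minus \<Sigma>"
  using box_imp_of_boxdot_imp[OF assms] box_cong by (rule imp_trans)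

lemma rhd_cong_under:
  assumes "J4plus \<subseteq> \<Sigma>"
    and "\<boxdot> E \<^bold>\<rightarrow> (A \<^bold>\<leftrightarrow> B) \<in> IL_minus \<Sigma>" "\<boxdot> E \<^bold>\<rightarrow> (C \<^bold>\<leftrightarrow> D) \<in> IL_minus \<Sigma>"
  shows "\<box> E \<^bold>\<rightarrow> ((A \<rhd> C) \<^bold>\<leftrightarrow> (B \<rhd> D)) \<in> IL_minus \<Sigma>"
  using imp_conjI[OF assms(2,3)[THEN box_imp_of_boxdot_imp]] rhd_cong[OF assms(1)]
  by (rule imp_trans)

lemma boxdot_imp_of_box_imp:
  assumes "\<box> E \<^bold>\<rightarrow> A \<in> IL_minus \<Sigma>"
  shows "\<boxdot> E \<^bold>\<rightarrow> A \<in> IL_minus \<Sigma>"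
  using assms by (rule taut_mp) (simp add: tautology_def)

text \<open>The unboxed conjunct serves the occurrences of p outside all modal operators, the boxed
  one those inside. Keeping both in the hypothesis lets the induction pass through \<box> and
  \<rhd>.\<close>

lemma subst_cong_boxdot:
  assumes "J4plus \<subseteq> \<Sigma>"
  shows "\<boxdot> (B \<^bold>\<leftrightarrow> C) \<^bold>\<rightarrow> (subst p B A \<^bold>\<leftrightarrow> subst p C A) \<in> IL_minus \<Sigma>"
proof (induction A)
  case (Imp A1 A2)
  then show ?case unfolding subst.simps by (rule imp_cong_under)
next
  case (Box A)
  then show ?case unfolding subst.simps by (rule boxdot_imp_of_box_imp[OF box_cong_under])
next
  case (Rhd A1 A2)
  then show ?case
    unfolding subst.simps by (rule boxdot_imp_of_box_imp[OF rhd_cong_under[OF assms]])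
qed (auto intro: IL_minus.L1 simp: tautology_def)

text \<open>For a variable, being modalized excludes p itself, so both substitutions agree and no
  unboxed equivalence is called for.\<close>

lemma subst_cong_box:
  assumes "J4plus \<subseteq> \<Sigma>" "modalized p A"
  shows "\<box> (B \<^bold>\<leftrightarrow> C) \<^bold>\<rightarrow> (subst p B A \<^bold>\<leftrightarrow> subst p C A) \<in> IL_minus \<Sigma>"
  using assms(2)
proof (induction A)
  case (Imp A1 A2)
  then show ?case unfolding subst.simps by (intro imp_cong_under) simp_all
next
  case (Box A)
  \<comment> \<open>The argument of a modal operator may fail to be modalized in p, so the \<boxdot>
    version takes the place of the induction hypothesis.\<close>
  show ?case
    unfolding subst.simps by (rule box_cong_under[OF subst_cong_boxdot[OF assms(1)]])
next
  case (Rhd A1 A2)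
  show ?case
    unfolding subst.simps
    by (rule rhd_cong_under[OF assms(1) subst_cong_boxdot subst_cong_boxdot, OF assms(1) assms(1)])
qed (auto intro: IL_minus.L1 simp: tautology_def)

lemma subst_Var_self: "subst p (Var p) A = A"
  by (induction A) auto

lemma fixed_point_unique:
  assumes "J4plus \<subseteq> \<Sigma>" "modalized p A"
  shows "\<boxdot> (Var p \<^bold>\<leftrightarrow> A) \<^bold>\<and> \<boxdot> (Var q \<^bold>\<leftrightarrow> subst p (Var q) A) \<^bold>\<rightarrow> (Var p \<^bold>\<leftrightarrow> Var q) \<in> IL_minus \<Sigma>"
    (is "?P \<^bold>\<and> ?Q \<^bold>\<rightarrow> ?D \<in> _")
proof (rule loeb_rule)
  have "?P \<^bold>\<and> ?Q \<^bold>\<rightarrow> \<box> ?P \<^bold>\<and> \<box> ?Q \<in> IL_minus \<Sigma>"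
    using boxdot_imp_box_boxdot[of "Var p \<^bold>\<leftrightarrow> A" \<Sigma>]
      boxdot_imp_box_boxdot[of "Var q \<^bold>\<leftrightarrow> subst p (Var q) A" \<Sigma>]
    by (rule taut_mp2) (simp add: tautology_def)
  then show "?P \<^bold>\<and> ?Q \<^bold>\<rightarrow> \<box> (?P \<^bold>\<and> ?Q) \<in> IL_minus \<Sigma>"
    using box_conj by (rule imp_trans)
  \<comment> \<open>Substituting p for itself makes A one side of the congruence.\<close>
  have "\<box> ?D \<^bold>\<rightarrow> (A \<^bold>\<leftrightarrow> subst p (Var q) A) \<in> IL_minus \<Sigma>"
    using subst_cong_box[OF assms, of "Var p" "Var q"] by (simp only: subst_Var_self)
  \<comment> \<open>The unboxed conjuncts of \<open>?P\<close> and \<open>?Q\<close> close the chain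
    from p to A, to A(q), to q.\<close>
  then show "?P \<^bold>\<and> ?Q \<^bold>\<rightarrow> (\<box> ?D \<^bold>\<rightarrow> ?D) \<in> IL_minus \<Sigma>"
    by (rule taut_mp) (unfold tautology_def truth.simps, blast)
qed

theorem theorem3p1:
  fixes L :: "fm set"
  assumes "extension L (IL_minus J4plus)"
  shows "UFP L"
  \<comment> \<open>The derivation lives in \<open>IL_minus J4plus\<close>, and inclusion carries
    its conclusion over to \<open>L\<close>.\<close>
  using assms fixed_point_unique[OF subset_refl]
  unfolding UFP_def extension_def by blast

end
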